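(* There is a sequence $(P_1^n,P_2^n)_{n\ge 1}$ of pairs of finite ordered sets such that for every $n$: (1) $P_1^n$ is not isomorphic to $P_2^n$; (2) $P_1^n$ and $P_2^n$ have equal marked maximal decks and equal marked minimal decks; (3) there are ranks $k_0,\ldots,k_n$ such that for each $i$, $P_1^n$ and $P_2^n$ have equal marked rank $k_i$ decks; (4) for any pair of isomorphic cards $P_1^n\setminus\{x\}$, $P_2^n\setminus\{y\}$ matched as in (2) and (3), the neighborhoods $\updownarrow_{P_1^n}x$ and $\updownarrow_{P_2^n}y$ are isomorphic; (5) there are only four ranks $k$ that do not produce any isomorphic cards, i.e. only four ranks $k$ for which there are no $x\in P_1^n$, $y\in P_2^n$ both of rank $k$ with $P_1^n\setminus\{x\}\cong P_2^n\setminus\{y\}$; (7) for every rank $k$, the rank $k$ neighborhood decks of $P_1^n$ and $P_2^n$ are equal; and moreover (6) $\liminf_{n\to\infty} ECR(P_1^n,P_2^n)\ge \frac{1}{10}$.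
   Context: All ordered sets are finite. The rank of $x\in P$ is the length (number of elements minus one) of the longest chain whose smallest element is a minimal element of $P$ and whose largest element is $x$. A card of $P$ is a one-point-deleted subset $P\setminus\{x\}$ with the induced order; a rank $k$ card is one where $x$ has rank $k$, the rank $k$ deck is the multiset of rank $k$ cards; the maximal (minimal) deck is the multiset of cards $P\setminus\{x\}$ with $x$ maximal (minimal). Two decks are equal if there is a bijection between them such that each card is isomorphic to its image. Marked decks are equal if such a bijection exists where each isomorphism additionally preserves the marking: for marked rank $k$ decks, the isomorphisms preserve the rank each element had in the original set; for marked maximal (minimal) decks, they map elements that were maximal (minimal) in the original set to elements maximal (minimal) in the original set. The neighborhood of $x$ is $\updownarrow x=\{p:p\ge x\}\cup\{p:p\le x\}$ with the induced order; the rank $k$ neighborhood deck is the multiset of neighborhoods of the points of rank $k$, and two such decks are equal if there is a bijection with each neighborhood isomorphic to its image. For two ordered sets $P_1,P_2$ of the same size $N$, the equal card ratio $ECR(P_1,P_2)$ is the number of isomorphic cards (the number of cards of $P_1$ that can be bijectively paired with isomorphic cards of $P_2$) divided by $N$. *)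

theory Defs
  imports Complex_Main "HOL-Library.Extended_Real" "HOL-Library.Liminf_Limsup"
begin

text \<open>
  A finite ordered set is a reflexive order relation \<open>r\<close> with point set \<open>Field r\<close>. Since \<open>r\<close> is
  reflexive, \<open>Field (Restr r A) = A\<close> for \<open>A \<subseteq> Field r\<close>, so induced orders on subsets are given by
  \<open>Restr\<close>. Isomorphisms are the library's \<open>iso\<close>: for arbitrary relations these are the
  bijections between the fields that preserve and reflect the relation (\<open>iso_iff2\<close>).
\<close>

definition finite_order :: "'a rel \<Rightarrow> bool" where
  "finite_order r \<longleftrightarrow> Partial_order r \<and> finite (Field r)"

definition isomorphic :: "'a rel \<Rightarrow> 'b rel \<Rightarrow> bool" where
  "isomorphic r s \<longleftrightarrow> (\<exists>f. iso r s f)"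

definition minimals :: "'a rel \<Rightarrow> 'a set" where
  "minimals r = {x \<in> Field r. \<forall>y. (y, x) \<in> r \<longrightarrow> y = x}"

definition maximals :: "'a rel \<Rightarrow> 'a set" where
  "maximals r = {x \<in> Field r. \<forall>y. (x, y) \<in> r \<longrightarrow> y = x}"

definition rank :: "'a rel \<Rightarrow> 'a \<Rightarrow> nat" where
  "rank r x = Max {card C - 1 | C. C \<in> Chains r \<and>
     (\<exists>m \<in> C. m \<in> minimals r \<and> (\<forall>c \<in> C. (m, c) \<in> r)) \<and>
     x \<in> C \<and> (\<forall>c \<in> C. (c, x) \<in> r)}"

definition rank_points :: "'a rel \<Rightarrow> nat \<Rightarrow> 'a set" where
  "rank_points r k = {x \<in> Field r. rank r x = k}"

definition point_deleted :: "'a rel \<Rightarrow> 'a \<Rightarrow> 'a rel" where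
  "point_deleted r x = Restr r (Field r - {x})"

definition neighborhood :: "'a rel \<Rightarrow> 'a \<Rightarrow> 'a rel" where
  "neighborhood r x = Restr r (above r x \<union> under r x)"

text \<open>
  A deck is a multiset indexed by the points at which its members are taken, so a bijection between
  two decks is a bijection between their index sets \<open>A\<close> and \<open>B\<close>; \<open>R x y\<close> says that the member
  at \<open>x\<close> is isomorphic (in the sense at hand) to the member at \<open>y\<close>.
\<close>

definition decks_equal :: "'a set \<Rightarrow> 'b set \<Rightarrow> ('a \<Rightarrow> 'b \<Rightarrow> bool) \<Rightarrow> bool" where
  "decks_equal A B R \<longleftrightarrow> (\<exists>\<beta>. bij_betw \<beta> A B \<and> (\<forall>x \<in> A. R x (\<beta> x)))"

definition isomorphic_cards :: "'a rel \<Rightarrow> 'b rel \<Rightarrow> 'a \<Rightarrow> 'b \<Rightarrow> bool" where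
  "isomorphic_cards r s x y \<longleftrightarrow> isomorphic (point_deleted r x) (point_deleted s y)"

definition isomorphic_neighborhoods :: "'a rel \<Rightarrow> 'b rel \<Rightarrow> 'a \<Rightarrow> 'b \<Rightarrow> bool" where
  "isomorphic_neighborhoods r s x y \<longleftrightarrow> isomorphic (neighborhood r x) (neighborhood s y)"

text \<open>In the marked notions, ranks and extremal points are those of the original sets, not of the cards.\<close>

definition rank_marked_cards :: "'a rel \<Rightarrow> 'b rel \<Rightarrow> 'a \<Rightarrow> 'b \<Rightarrow> bool" where
  "rank_marked_cards r s x y \<longleftrightarrow>
     (\<exists>f. iso (point_deleted r x) (point_deleted s y) f \<and>
          (\<forall>p \<in> Field r - {x}. rank s (f p) = rank r p))"

definition max_marked_cards :: "'a rel \<Rightarrow> 'b rel \<Rightarrow> 'a \<Rightarrow> 'b \<Rightarrow> bool" where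
  "max_marked_cards r s x y \<longleftrightarrow>
     (\<exists>f. iso (point_deleted r x) (point_deleted s y) f \<and>
          (\<forall>p \<in> maximals r - {x}. f p \<in> maximals s))"

definition min_marked_cards :: "'a rel \<Rightarrow> 'b rel \<Rightarrow> 'a \<Rightarrow> 'b \<Rightarrow> bool" where
  "min_marked_cards r s x y \<longleftrightarrow>
     (\<exists>f. iso (point_deleted r x) (point_deleted s y) f \<and>
          (\<forall>p \<in> minimals r - {x}. f p \<in> minimals s))"

definition equal_marked_rank_decks :: "nat \<Rightarrow> 'a rel \<Rightarrow> 'b rel \<Rightarrow> bool" where
  "equal_marked_rank_decks k r s \<longleftrightarrow>
     decks_equal (rank_points r k) (rank_points s k) (rank_marked_cards r s)"

definition equal_marked_maximal_decks :: "'a rel \<Rightarrow> 'b rel \<Rightarrow> bool" where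
  "equal_marked_maximal_decks r s \<longleftrightarrow>
     decks_equal (maximals r) (maximals s) (max_marked_cards r s)"

definition equal_marked_minimal_decks :: "'a rel \<Rightarrow> 'b rel \<Rightarrow> bool" where
  "equal_marked_minimal_decks r s \<longleftrightarrow>
     decks_equal (minimals r) (minimals s) (min_marked_cards r s)"

definition equal_rank_neighborhood_decks :: "nat \<Rightarrow> 'a rel \<Rightarrow> 'b rel \<Rightarrow> bool" where
  "equal_rank_neighborhood_decks k r s \<longleftrightarrow>
     decks_equal (rank_points r k) (rank_points s k) (isomorphic_neighborhoods r s)"

text \<open>The number of isomorphic cards is the largest size of a partial matching between the two decks.
  The ratio is meant for ordered sets of equal size.\<close>

definition isomorphic_card_count :: "'a rel \<Rightarrow> 'b rel \<Rightarrow> nat" where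
  "isomorphic_card_count r s = Max {card A | A. A \<subseteq> Field r \<and>
     (\<exists>f. inj_on f A \<and> f ` A \<subseteq> Field s \<and> (\<forall>x \<in> A. isomorphic_cards r s x (f x)))}"

definition ECR :: "'a rel \<Rightarrow> 'b rel \<Rightarrow> real" where
  "ECR r s = real (isomorphic_card_count r s) / real (card (Field r))"

end

theory Submission
  imports Defs "HOL-Library.Countable"
begin

text \<open>
  The two ordered sets are twisted versions of one structure, in the manner of Cai, Fuerer and Immerman.
  A row of pairs is joined by links, so that the symmetries exchanging the two points of some of the
  pairs are free up to the links. Every decoration (a minimal point, or a point of one of the upper
  ranks) distinguishes one half of a pair or of a link. Twisting a single decoration changes the parity
  of the structure, which is an isomorphism invariant; but a twist can be moved along the row from one
  decoration to any other, so it disappears as soon as any decoration is deleted. Hence all cards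
  at decorations agree, and the decorations make up all ranks except the four that carry the row.

  The parity survives the deletion of a point that is not a decoration: it is witnessed by two disjoint
  walks along the row, at least one of which avoids the deleted point.
\<close>

section \<open>Ranks from a height function\<close>

text \<open>The points of a chain below \<open>x\<close> have distinct heights, all at most
  \<open>h x\<close>, which bounds its size; going down one height at a time ends in a minimal point
  and attains the bound.\<close>

lemma rank_eqI:
  fixes h :: "'a \<Rightarrow> nat"
  assumes po: "finite_order r"
    and mono: "\<And>x y. (x, y) \<in> r \<Longrightarrow> x \<noteq> y \<Longrightarrow> h x < h y"
    and step: "\<And>x. x \<in> Field r \<Longrightarrow> 0 < h x \<Longrightarrow> \<exists>y. (y, x) \<in> r \<and> Suc (h y) = h x"
    and x: "x \<in> Field r"
  shows "rank r x = h x"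
proof -
  have refl: "\<And>z. z \<in> Field r \<Longrightarrow> (z, z) \<in> r" and tr: "trans r"
    using po by (auto simp: finite_order_def partial_order_on_def preorder_on_def refl_on_def)
  let ?ok = "\<lambda>x C. C \<in> Chains r \<and> (\<exists>m \<in> C. m \<in> minimals r \<and> (\<forall>c \<in> C. (m, c) \<in> r)) \<and>
     x \<in> C \<and> (\<forall>c \<in> C. (c, x) \<in> r)"
  have ex: "\<exists>C. ?ok x C \<and> finite C \<and> card C = Suc (h x)" if "x \<in> Field r" for x
    using that
  proof (induction "h x" arbitrary: x)
    case 0
    have "x \<in> minimals r"
      using 0 mono by (fastforce simp: minimals_def)
    with 0 show ?case
      by (intro exI[of _ "{x}"]) (auto simp: Chains_def refl)
  next
    case (Suc k)
    obtain y where y: "(y, x) \<in> r" "Suc (h y) = h x"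
      using step[OF Suc.prems] Suc.hyps(2) by (metis zero_less_Suc)
    have "y \<in> Field r" using y(1) by (auto simp: Field_def)
    then obtain C m where C: "?ok y C" "finite C" "card C = Suc (h y)"
        and m: "m \<in> C" "m \<in> minimals r" "\<forall>c \<in> C. (m, c) \<in> r"
      using Suc.hyps y by (metis Suc_inject)
    have below: "(c, x) \<in> r" if "c \<in> C" for c
      using C(1) that y(1) tr by (meson transD)
    have "x \<notin> C"
    proof
      assume "x \<in> C"
      then have "(x, y) \<in> r" using C(1) by blast
      then show False using mono[of x y] y(2) by (cases "x = y") auto
    qed
    then show ?case
      using C m below y(2) Suc.prems refl
      by (intro exI[of _ "insert x C"]) (auto simp: Chains_def)
  qed
  have le: "card C - 1 \<le> h x" if "?ok x C" for C
  proof -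
    have "inj_on h C"
      using that mono by (fastforce simp: inj_on_def Chains_def)
    moreover have "h c \<le> h x" if "c \<in> C" for c
      using \<open>?ok x C\<close> that mono[of c x] by (cases "c = x") auto
    then have "h ` C \<subseteq> {..h x}" by auto
    ultimately have "card C \<le> card {..h x}"
      by (intro card_inj_on_le) auto
    then show ?thesis by simp
  qed
  let ?S = "{card C - 1 | C. ?ok x C}"
  have "?S \<subseteq> {..h x}"
  proof
    fix k assume "k \<in> ?S"
    then obtain C where C: "k = card C - 1 \<and> ?ok x C" by (elim CollectE exE)
    show "k \<in> {..h x}"
      unfolding conjunct1[OF C] atMost_iff by (rule le[OF conjunct2[OF C]])
  qed
  then have "finite ?S" by (rule finite_subset) simp
  moreover have "h x \<in> ?S"
  proof -
    obtain C where C: "?ok x C \<and> finite C \<and> card C = Suc (h x)" using ex[OF x] by (rule exE)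
    then have "h x = card C - 1" by simp
    with C show ?thesis by (intro CollectI exI[of _ C]) (elim conjE, intro conjI)
  qed
  ultimately have "Max ?S = h x"
    by (intro Max_eqI) (use \<open>?S \<subseteq> {..h x}\<close> in auto)
  then show ?thesis by (simp add: rank_def)
qed

section \<open>The row of pairs, its order and its ranks\<close>

text \<open>
  \<open>Q j x\<close> is a point of the \<open>j\<close>-th pair. \<open>G i y z\<close> links \<open>Q i y\<close> and \<open>Q (i+1) z\<close>, and \<open>E b y\<close> is one of the
  undecorated links at the two ends of the row. \<open>V b\<close> decorates the end pair and \<open>U i\<close> the link \<open>G i\<close>.
  The chain of the \<open>W k\<close> only raises the rank of the \<open>U i\<close>, so that there are exactly four ranks without
  decorations.

  In \<open>lt K d\<close> the twist sits at position \<open>d\<close> of the row, where \<open>0\<close> and \<open>2*K+3\<close> are the decorations \<open>V\<close> of the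
  ends, \<open>1\<close> and \<open>2*K+2\<close> the links \<open>E\<close>, and \<open>i+1\<close> is \<open>U i\<close>; the value \<open>2*K+4\<close> means no twist.
  The excluded pairs \<open>j = 1\<close>, \<open>j = 2*K+1\<close> below \<open>Q j x\<close> and the fact that \<open>E b y\<close> lies below only one maximal
  point interrupt the row inside the neighborhoods of the extremal points, which therefore do not
  see the parity.
\<close>

datatype pt = V bool | Q nat bool | G nat bool bool | E bool bool | W nat | U nat

instance pt :: countable by countable_datatype

text \<open>The distance of \<open>i\<close> from the middle of the row: \<open>0\<close> at
  \<open>K\<close> and \<open>K+1\<close>, and \<open>K-1\<close> at the ends \<open>1\<close> and
  \<open>2*K\<close>. Among the indices from \<open>1\<close> to \<open>2*K\<close> exactly
  \<open>i\<close> and \<open>2*K+1-i\<close> share a value, so each upper rank holds two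
  decorations.\<close>

definition lev :: "nat \<Rightarrow> nat \<Rightarrow> nat" where
  "lev K i = (if i \<le> K then K - i else i - K - 1)"

fun lt :: "nat \<Rightarrow> nat \<Rightarrow> pt \<Rightarrow> pt \<Rightarrow> bool" where
  "lt K d (V b) c = (case c of V _ \<Rightarrow> False
     | Q j x \<Rightarrow> if b then j \<noteq> 2*K+1 \<and> (j = 2*K+2 \<longrightarrow> x = (d = 2*K+3))
                else j \<noteq> 1 \<and> (j = 0 \<longrightarrow> x = (d = 0))
     | _ \<Rightarrow> True)"
| "lt K d (Q j x) c = (case c of V _ \<Rightarrow> False | Q _ _ \<Rightarrow> False
     | G i y z \<Rightarrow> j = i \<and> x = y \<or> j = i+1 \<and> x = z
     | E b y \<Rightarrow> if b then j = 2*K+2 \<and> x = y \<or> j = 2*K+1 \<and> x = (y = (d = 2*K+2))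
                else j = 0 \<and> x = y \<or> j = 1 \<and> x = (y = (d = 1))
     | _ \<Rightarrow> True)"
| "lt K d (G i y z) c = (case c of
       U k \<Rightarrow> lev K i < lev K k \<or> lev K i = lev K k \<and> (i = k \<longrightarrow> (y = z) \<noteq> (d = i+1))
     | _ \<Rightarrow> False)"
| "lt K d (E b y) c = (case c of U k \<Rightarrow> k = (if b then 1 else 2*K) | _ \<Rightarrow> False)"
| "lt K d (W k) c = (case c of W l \<Rightarrow> k < l | U _ \<Rightarrow> True | _ \<Rightarrow> False)"
| "lt K d (U i) c = (case c of U k \<Rightarrow> lev K i < lev K k | _ \<Rightarrow> False)"

text \<open>This will be the rank. It does not mention \<open>d\<close>, so both orders have the
  same ranks and isomorphisms of cards can preserve them.\<close>

fun level :: "nat \<Rightarrow> pt \<Rightarrow> nat" where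
  "level K (V b) = 0"
| "level K (Q j x) = 1"
| "level K (G i y z) = 2"
| "level K (E b y) = 2"
| "level K (W k) = 2 + k"
| "level K (U i) = 5 + lev K i"

definition pts :: "nat \<Rightarrow> pt set" where
  "pts K = {c. case c of V b \<Rightarrow> True | Q j x \<Rightarrow> j \<le> 2*K+2 | G i y z \<Rightarrow> 1 \<le> i \<and> i \<le> 2*K
     | E b y \<Rightarrow> True | W k \<Rightarrow> k < 3 | U i \<Rightarrow> 1 \<le> i \<and> i \<le> 2*K}"

lemma in_pts [simp]:
  "V b \<in> pts K" "Q j x \<in> pts K \<longleftrightarrow> j \<le> 2*K+2" "G i y z \<in> pts K \<longleftrightarrow> 1 \<le> i \<and> i \<le> 2*K"
  "E b y \<in> pts K" "W k \<in> pts K \<longleftrightarrow> k < 3" "U i \<in> pts K \<longleftrightarrow> 1 \<le> i \<and> i \<le> 2*K"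
  by (simp_all add: pts_def)

lemma pts_subset:
  "pts K \<subseteq> V ` UNIV \<union> (\<lambda>(j, x). Q j x) ` ({..2*K+2} \<times> UNIV) \<union>
     (\<lambda>(i, y, z). G i y z) ` ({1..2*K} \<times> UNIV \<times> UNIV) \<union> (\<lambda>(b, y). E b y) ` (UNIV \<times> UNIV) \<union>
     W ` {..<3} \<union> U ` {1..2*K}" (is "_ \<subseteq> ?R")
proof
  fix c assume "c \<in> pts K" then show "c \<in> ?R" by (cases c) (force simp: image_iff)+
qed

lemma finite_pts: "finite (pts K)"
  by (rule finite_subset[OF pts_subset]) auto

lemma card_pts: "card (pts K) \<le> 14*K + 15"
proof -
  have un: "card (A \<union> B) \<le> a + b" if "card A \<le> a" "card B \<le> b" for A B :: "pt set" and a b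
    using that card_Un_le[of A B] by linarith
  have im: "card (f ` A) \<le> a" if "finite A" "card A \<le> a" for f :: "'b \<Rightarrow> pt" and A a
    using that card_image_le[of A f] by linarith
  have "card (pts K) \<le> 2 + (2*K+3)*2 + (2*K)*4 + 4 + 3 + 2*K"
  proof (rule order.trans[OF card_mono[OF _ pts_subset]])
    show "card (V ` UNIV \<union> (\<lambda>(j, x). Q j x) ` ({..2*K+2} \<times> UNIV) \<union>
     (\<lambda>(i, y, z). G i y z) ` ({1..2*K} \<times> UNIV \<times> UNIV) \<union> (\<lambda>(b, y). E b y) ` (UNIV \<times> UNIV) \<union>
     W ` {..<3} \<union> U ` {1..2*K}) \<le> 2 + (2*K+3)*2 + (2*K)*4 + 4 + 3 + 2*K"
      by (intro un im) (simp_all add: card_cartesian_product del: UNIV_Times_UNIV)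
  qed auto
  then show ?thesis by simp
qed

lemma lt_level: "lt K d a b \<Longrightarrow> level K a < level K b" if "b \<in> pts K" "a \<in> pts K"
  using that by (cases a; cases b) auto

lemma lt_trans: "lt K d a b \<Longrightarrow> lt K d b c \<Longrightarrow> lt K d a c" if "a \<in> pts K" "b \<in> pts K" "c \<in> pts K"
  using that by (cases a; cases b; cases c) (auto simp: lev_def split: if_splits)

lemma lt_irrefl [simp]: "\<not> lt K d a a"
  by (cases a) auto

lemma level_step:
  assumes "1 \<le> K" "b \<in> pts K" "0 < level K b"
  shows "\<exists>a \<in> pts K. lt K d a b \<and> Suc (level K a) = level K b"
proof (cases b)
  case (Q j x)
  then show ?thesis using assms
    \<comment> \<open>\<open>V True\<close> lies below the pairs \<open>0\<close> and
      \<open>1\<close> and \<open>V False\<close> below the pairs from \<open>2\<close> onwards,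
      whatever the twist.\<close>
    by (intro bexI[of _ "V (j < 2)"]) auto
next
  case (G i y z)
  then show ?thesis using assms by (intro bexI[of _ "Q i y"]) auto
next
  case (E b y)
  then show ?thesis using assms by (intro bexI[of _ "Q (if b then 2*K+2 else 0) y"]) auto
next
  case (W k)
  then show ?thesis using assms
    by (cases k; intro bexI[of _ "if k = 0 then Q 0 True else W (k - 1)"]) auto
next
  case (U i)
  show ?thesis
  proof (cases "lev K i")
    case 0
    then show ?thesis using U by (intro bexI[of _ "W 2"]) auto
  next
    case (Suc l)
    then show ?thesis using U assms
      by (intro bexI[of _ "U (if i \<le> K then i + 1 else i - 1)"]) (auto simp: lev_def split: if_splits)
  qed
qed (use assms in auto)

section \<open>Transfer to relations on the natural numbers\<close>

text \<open>Points are coded by \<open>to_nat\<close> because the orders asked for live on numbers.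
  The free carrier \<open>A\<close> gives cards and neighborhoods the same form.\<close>

definition rel :: "nat \<Rightarrow> nat \<Rightarrow> pt set \<Rightarrow> nat rel" where
  "rel K d A = {(to_nat a, to_nat b) | a b. a \<in> A \<and> b \<in> A \<and> (a = b \<or> lt K d a b)}"

lemma in_rel [simp]: "(to_nat a, to_nat b) \<in> rel K d A \<longleftrightarrow> a \<in> A \<and> b \<in> A \<and> (a = b \<or> lt K d a b)"
  by (auto simp: rel_def)

lemma Field_rel [simp]: "Field (rel K d A) = to_nat ` A"
  by (auto simp: rel_def Field_def)

lemma to_nat_mem [simp]: "to_nat a \<in> to_nat ` A \<longleftrightarrow> a \<in> (A :: pt set)"
  by (auto simp: image_iff)

lemma finite_order_rel: "finite_order (rel K d (pts K))"
  unfolding finite_order_def partial_order_on_def preorder_on_def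
proof (intro conjI)
  show "refl_on (Field (rel K d (pts K))) (rel K d (pts K))"
    by (auto simp: refl_on_def)
  show "trans (rel K d (pts K))"
    by (rule transI) (auto simp: rel_def dest: lt_trans)
  show "antisym (rel K d (pts K))"
    by (rule antisymI) (auto simp: rel_def dest: lt_level, meson lt_level less_asym)
  show "finite (Field (rel K d (pts K)))"
    by (simp add: finite_pts)
  show "rel K d (pts K) \<subseteq> Field (rel K d (pts K)) \<times> Field (rel K d (pts K))"
    by (auto simp: Field_def)
qed

lemma rank_rel:
  assumes "1 \<le> K" "a \<in> pts K"
  shows "rank (rel K d (pts K)) (to_nat a) = level K a"
proof -
  have "rank (rel K d (pts K)) (to_nat a) = level K (from_nat (to_nat a))"
  proof (rule rank_eqI[OF finite_order_rel, where h = "\<lambda>z. level K (from_nat z)"])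
    fix x y assume "(x, y) \<in> rel K d (pts K)" "x \<noteq> y"
    then show "level K (from_nat x) < level K (from_nat y)"
      by (auto simp: rel_def dest: lt_level)
  next
    fix x assume "x \<in> Field (rel K d (pts K))" "0 < level K (from_nat x)"
    then obtain b where b: "b \<in> pts K" "x = to_nat b" "0 < level K b" by auto
    then obtain c where "c \<in> pts K" "lt K d c b" "Suc (level K c) = level K b"
      using level_step[OF assms(1)] by blast
    with b show "\<exists>y. (y, x) \<in> rel K d (pts K) \<and> Suc (level K (from_nat y)) = level K (from_nat x)"
      by (intro exI[of _ "to_nat c"]) auto
  qed (use assms in auto)
  then show ?thesis by simp
qed

lemma Restr_rel: "Restr (rel K d A) (to_nat ` B) = rel K d (A \<inter> B)"
  by (auto simp: rel_def)

lemma point_deleted_rel: "point_deleted (rel K d A) (to_nat a) = rel K d (A - {a})"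
proof -
  have "to_nat ` A - {to_nat a} = to_nat ` (A - {a})" by auto
  then show ?thesis by (simp add: point_deleted_def Restr_rel Int_absorb1)
qed

definition nbhd :: "nat \<Rightarrow> nat \<Rightarrow> pt \<Rightarrow> pt set" where
  "nbhd K d a = {c \<in> pts K. c = a \<or> lt K d a c \<or> lt K d c a}"

lemma neighborhood_rel:
  assumes "a \<in> pts K"
  shows "neighborhood (rel K d (pts K)) (to_nat a) = rel K d (nbhd K d a)"
proof -
  have "above (rel K d (pts K)) (to_nat a) \<union> under (rel K d (pts K)) (to_nat a) = to_nat ` nbhd K d a"
    using assms by (auto simp: above_def under_def nbhd_def rel_def)
  moreover have "pts K \<inter> nbhd K d a = nbhd K d a" by (auto simp: nbhd_def)
  ultimately show ?thesis by (simp add: neighborhood_def Restr_rel)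
qed

definition pt_iso :: "nat \<Rightarrow> nat \<Rightarrow> pt set \<Rightarrow> nat \<Rightarrow> pt set \<Rightarrow> (pt \<Rightarrow> pt) \<Rightarrow> bool" where
  "pt_iso K d A e B h \<longleftrightarrow> bij_betw h A B \<and> (\<forall>a \<in> A. \<forall>b \<in> A. lt K d a b \<longleftrightarrow> lt K e (h a) (h b))"

lemma pt_iso_trans: "pt_iso K d A e B h \<Longrightarrow> pt_iso K e B f C k \<Longrightarrow> pt_iso K d A f C (k \<circ> h)"
  unfolding pt_iso_def using bij_betw_trans[of h A B k C] by (auto simp: bij_betw_apply)

definition nat_map :: "(pt \<Rightarrow> pt) \<Rightarrow> nat \<Rightarrow> nat" where
  "nat_map h z = to_nat (h (from_nat z))"

lemma nat_map [simp]: "nat_map h (to_nat a) = to_nat (h a)"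
  by (simp add: nat_map_def)

lemma bij_betw_nat_map: "bij_betw h A B \<Longrightarrow> bij_betw (nat_map h) (to_nat ` A) (to_nat ` B)"
  by (auto simp: bij_betw_def inj_on_def image_iff)

lemma iso_rel:
  assumes "pt_iso K d A e B h"
  shows "iso (rel K d A) (rel K e B) (nat_map h)"
proof -
  have "bij_betw h A B" and *: "\<And>a b. a \<in> A \<Longrightarrow> b \<in> A \<Longrightarrow> lt K d a b \<longleftrightarrow> lt K e (h a) (h b)"
    using assms by (auto simp: pt_iso_def)
  then have "inj_on h A" "\<And>a. a \<in> A \<Longrightarrow> h a \<in> B" by (auto simp: bij_betw_def)
  then show ?thesis
    using bij_betw_nat_map[OF \<open>bij_betw h A B\<close>] * by (auto simp: iso_iff2 inj_on_eq_iff)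
qed

lemma isomorphic_relD:
  assumes "isomorphic (rel K d A) (rel K e B)"
  shows "\<exists>h. pt_iso K d A e B h"
proof -
  obtain f where iso: "iso (rel K d A) (rel K e B) f"
    using assms by (auto simp: isomorphic_def)
  note f = iso[unfolded iso_iff2 Field_rel, THEN conjunct1]
    iso[unfolded iso_iff2 Field_rel, THEN conjunct2, THEN bspec, THEN bspec]
  define h where "h a = (from_nat (f (to_nat a)) :: pt)" for a :: pt
  have h: "f (to_nat a) = to_nat (h a) \<and> h a \<in> B" if "a \<in> A" for a
  proof -
    have "f (to_nat a) \<in> to_nat ` B" using f(1) that by (auto simp: bij_betw_def)
    then show ?thesis by (auto simp: h_def)
  qed
  have inj: "inj_on h A"
  proof (rule inj_onI)
    fix a b assume "a \<in> A" "b \<in> A" "h a = h b"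
    then have "f (to_nat a) = f (to_nat b)" using h by simp
    then show "a = b"
      using inj_onD[OF bij_betw_imp_inj_on[OF f(1)], of "to_nat a" "to_nat b"] \<open>a \<in> A\<close> \<open>b \<in> A\<close> by simp
  qed
  have "B \<subseteq> h ` A"
  proof
    fix b assume "b \<in> B"
    then have "to_nat b \<in> f ` (to_nat ` A)"
      unfolding bij_betw_imp_surj_on[OF f(1)] by (rule imageI)
    then obtain a where "a \<in> A" "to_nat b = f (to_nat a)"
      by (elim imageE) simp
    then show "b \<in> h ` A" using h[of a] by auto
  qed
  moreover have "h ` A \<subseteq> B" using h by blast
  ultimately have "bij_betw h A B" using inj unfolding bij_betw_def by blast
  moreover have "lt K d a b \<longleftrightarrow> lt K e (h a) (h b)" if "a \<in> A" "b \<in> A" for a b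
  proof (cases "a = b")
    case False
    then have "h a \<noteq> h b" using inj that by (meson inj_onD)
    with False show ?thesis
      using f(2)[OF imageI[OF that(1)] imageI[OF that(2)]] that h[OF that(1)] h[OF that(2)]
      unfolding h[OF that(1), THEN conjunct1] h[OF that(2), THEN conjunct1] in_rel by blast
  qed simp
  ultimately show ?thesis unfolding pt_iso_def by blast
qed

section \<open>Moving the twist along the row\<close>

text \<open>Exchanges the points of every pair to the right of position \<open>d\<close>. The labels
  of a link \<open>G\<close> follow the pairs that it joins, and that of a link \<open>E\<close>
  follows the end pair.\<close>

fun flip :: "nat \<Rightarrow> nat \<Rightarrow> pt \<Rightarrow> pt" where
  "flip K d (Q j x) = Q j (x \<noteq> (d \<le> j))"
| "flip K d (G i y z) = G i (y \<noteq> (d \<le> i)) (z \<noteq> (d \<le> i+1))"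
| "flip K d (E b y) = E b (y \<noteq> (d \<le> (if b then 2*K+2 else 0)))"
| "flip K d c = c"

lemma flip_flip [simp]: "flip K d (flip K d c) = c"
  by (cases c) auto

lemma level_flip [simp]: "level K (flip K d c) = level K c"
  by (cases c) auto

lemma flip_in_pts [simp]: "flip K d c \<in> pts K \<longleftrightarrow> c \<in> pts K"
  by (cases c) auto

text \<open>For \<open>d < 2*K+3\<close> the exchange reverses the relation at \<open>d\<close>,
  which cancels the twist there, and at \<open>2*K+3\<close>, where the exchanged last pair meets
  the fixed \<open>V True\<close>. For \<open>d = 2*K+3\<close> nothing moves.\<close>

lemma lt_flip:
  assumes "d \<le> 2*K+3" "a \<in> pts K" "b \<in> pts K"
  shows "lt K d a b \<longleftrightarrow> lt K (2*K+3) (flip K d a) (flip K d b)"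
proof (cases a)
  case (V c)
  then show ?thesis using assms by (cases b) auto
next
  case (Q j x)
  show ?thesis
  proof (cases b)
    case (G i y z)
    then show ?thesis using Q assms by simp blast
  next
    case (E c y)
    show ?thesis
    proof (cases c)
      case True
      with Q E assms show ?thesis by (cases x; cases y; cases "d = 2*K+2"; simp; arith)
    next
      case False
      with Q E assms show ?thesis by (cases x; cases y; cases "d = 0"; cases "d = 1"; simp; arith)
    qed
  qed (use Q in simp_all)
next
  case (G i y z)
  with assms show ?thesis by (cases b; simp; cases "d = i+1"; simp; arith)
qed (cases b; simp)+

lemma flip_eq_iff [simp]: "flip K d a = flip K d b \<longleftrightarrow> a = b"
  by (metis flip_flip)

lemma bij_flip:
  assumes "\<And>x. flip K d x \<in> B \<longleftrightarrow> x \<in> A"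
  shows "bij_betw (flip K d) A B"
proof -
  have "flip K d x \<in> A \<longleftrightarrow> x \<in> B" for x
    using assms[of "flip K d x"] by simp
  with assms show ?thesis
    by (intro bij_betw_byWitness[where f' = "flip K d"]) auto
qed

fun decor :: "pt \<Rightarrow> bool" where
  "decor (V b) = True" | "decor (U i) = True" | "decor _ = False"

lemma flip_decor [simp]: "decor c \<Longrightarrow> flip K d c = c"
  by (cases c) auto

lemma flip_eq_decor_iff: "decor c \<Longrightarrow> flip K d x = c \<longleftrightarrow> x = c"
  by (cases c; cases x) auto

fun twist :: "nat \<Rightarrow> pt \<Rightarrow> nat" where
  "twist K (V b) = (if b then 2*K+3 else 0)"
| "twist K (U i) = i+1"
| "twist K _ = 0"

text \<open>The pairs of points whose order depends on the twist being at \<open>d\<close>.\<close>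

inductive touches :: "nat \<Rightarrow> nat \<Rightarrow> pt \<Rightarrow> pt \<Rightarrow> bool" for K where
  "touches K 0 (V False) (Q 0 x)"
| "touches K (2*K+3) (V True) (Q (2*K+2) x)"
| "touches K 1 (Q 1 x) (E False y)"
| "touches K (2*K+2) (Q (2*K+1) x) (E True y)"
| "touches K (i+1) (G i y z) (U i)"

lemma lt_untwisted:
  assumes "\<not> touches K d a b" "a \<in> pts K"
  shows "lt K (2*K+4) a b \<longleftrightarrow> lt K d a b"
proof (cases a)
  case (V c)
  with assms show ?thesis by (cases b; cases c) (auto simp: touches.simps)
next
  case (Q j x)
  show ?thesis
  proof (cases b)
    case (E c y)
    show ?thesis
    proof (cases c)
      case True
      with Q E assms show ?thesis by (cases "d = 2*K+2") (simp_all add: touches.simps)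
    next
      case False
      with Q E assms show ?thesis by (cases "d = 1") (simp_all add: touches.simps)
    qed
  qed (use Q in simp_all)
next
  case (G i y z)
  with assms show ?thesis by (cases b) (auto simp: touches.simps)
qed (cases b; simp)+

text \<open>A twist at position \<open>twist K c\<close> affects only relations that involve
  \<open>c\<close>. Once \<open>c\<close> is gone, the untwisted order is also the order twisted
  there, and \<open>flip\<close> moves that twist to \<open>2*K+3\<close>.\<close>

lemma pt_iso_card:
  assumes "decor c" "c \<in> pts K"
  shows "pt_iso K (2*K+4) (pts K - {c}) (2*K+3) (pts K - {c}) (flip K (twist K c))"
  unfolding pt_iso_def
proof (intro conjI ballI)
  show "bij_betw (flip K (twist K c)) (pts K - {c}) (pts K - {c})"
    by (rule bij_flip) (simp add: flip_eq_decor_iff[OF assms(1)])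
  fix a b assume ab: "a \<in> pts K - {c}" "b \<in> pts K - {c}"
  have "\<not> touches K (twist K c) a b"
  proof
    assume "touches K (twist K c) a b"
    then show False
      using ab assms by cases (cases c; simp split: if_splits)+
  qed
  moreover have "twist K c \<le> 2*K+3" using assms by (cases c) auto
  ultimately show "lt K (2*K+4) a b \<longleftrightarrow> lt K (2*K+3) (flip K (twist K c) a) (flip K (twist K c) b)"
    using ab lt_untwisted[of K "twist K c" a b] lt_flip[of "twist K c" K a b] by blast
qed

section \<open>Neighborhoods do not see the parity\<close>

text \<open>A position at which a twist cannot be seen within the neighborhood of the point.\<close>

fun nbhd_twist :: "nat \<Rightarrow> pt \<Rightarrow> nat" where
  "nbhd_twist K (V b) = (if b then 2*K+2 else 1)"
| "nbhd_twist K (Q j x) = (if j = 2*K+2 then 0 else 2*K+3)"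
| "nbhd_twist K (G i y z) = 2*K+3"
| "nbhd_twist K (E b y) = (if b then 0 else 2*K+3)"
| "nbhd_twist K (W k) = 1"
| "nbhd_twist K (U i) = (if i = 2*K then 2*K+2 else 1)"

text \<open>A twist is inserted where it is invisible near \<open>c\<close> and then moved to
  \<open>2*K+3\<close>. The position depends on \<open>c\<close>, but the image of \<open>c\<close>
  is always \<open>flip K (2*K+2) c\<close>, so one bijection of the points serves a whole
  neighborhood deck.\<close>

lemma nbhd_pt_iso:
  assumes "1 \<le> K" "c \<in> pts K"
  shows "pt_iso K (2*K+4) (nbhd K (2*K+4) c) (2*K+3) (nbhd K (2*K+3) (flip K (2*K+2) c))
    (flip K (nbhd_twist K c))"
proof -
  let ?d = "nbhd_twist K c"
  have d: "?d \<le> 2*K+3" by (cases c) auto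
  have fl: "flip K ?d c = flip K (2*K+2) c" using assms by (cases c) auto
  have "\<not> touches K ?d c b" "\<not> touches K ?d b c" if "b \<in> pts K" for b
    using assms that by (cases c; auto simp: touches.simps split: if_splits)+
  then have eq: "nbhd K (2*K+4) c = nbhd K ?d c"
    using lt_untwisted[of K ?d c] lt_untwisted[of K ?d _ c] assms(2) by (auto simp: nbhd_def)
  have untouched: "\<not> touches K ?d a b" if "a \<in> nbhd K ?d c" "b \<in> nbhd K ?d c" for a b
  proof
    assume "touches K ?d a b"
    then show False
      using that assms unfolding nbhd_def
      by cases (cases c; simp split: if_splits)+
  qed
  have sub: "nbhd K ?d c \<subseteq> pts K" by (auto simp: nbhd_def)
  show ?thesis
    unfolding pt_iso_def eq fl[symmetric]
  proof (intro conjI ballI)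
    show "bij_betw (flip K ?d) (nbhd K ?d c) (nbhd K (2*K+3) (flip K ?d c))"
    proof (rule bij_flip)
      fix x
      show "flip K ?d x \<in> nbhd K (2*K+3) (flip K ?d c) \<longleftrightarrow> x \<in> nbhd K ?d c"
        using lt_flip[OF d, of x c] lt_flip[OF d, of c x] assms(2) unfolding nbhd_def by auto
    qed
    fix a b assume "a \<in> nbhd K ?d c" "b \<in> nbhd K ?d c"
    with sub show "lt K (2*K+4) a b \<longleftrightarrow> lt K (2*K+3) (flip K ?d a) (flip K ?d b)"
      using untouched[of a b] lt_untwisted[of K ?d a b] lt_flip[OF d, of a b] by blast
  qed
qed

section \<open>The reflection of the row\<close>

text \<open>Cards at the two decorations of one level may be matched with each other; the reflection
  exchanges these two decorations.\<close>

fun mirror :: "nat \<Rightarrow> pt \<Rightarrow> pt" where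
  "mirror K (V b) = V (\<not> b)"
| "mirror K (Q j x) = Q (2*K+2 - j) x"
| "mirror K (G i y z) = G (2*K+1 - i) z y"
| "mirror K (E b y) = E (\<not> b) y"
| "mirror K (W k) = W k"
| "mirror K (U i) = U (2*K+1 - i)"

lemma mirror_in_pts: "c \<in> pts K \<Longrightarrow> mirror K c \<in> pts K"
  by (cases c) auto

lemma mirror_mirror: "c \<in> pts K \<Longrightarrow> mirror K (mirror K c) = c"
  by (cases c) auto

lemma lt_mirror:
  assumes "1 \<le> K" "a \<in> pts K" "b \<in> pts K"
  shows "lt K (2*K+4) (mirror K a) (mirror K b) \<longleftrightarrow> lt K (2*K+4) a b"
  using assms by (cases a; cases b) (auto simp: lev_def)

lemma decor_level_eq:
  assumes "a \<in> pts K" "b \<in> pts K" "decor a" "decor b" "level K a = level K b"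
  shows "b = a \<or> b = mirror K a"
  using assms by (cases a; cases b) (auto simp: lev_def split: if_splits)

lemma nbhd_mirror_iso:
  assumes "1 \<le> K" "c \<in> pts K"
  shows "pt_iso K (2*K+4) (nbhd K (2*K+4) c) (2*K+4) (nbhd K (2*K+4) (mirror K c)) (mirror K)"
proof -
  have *: "mirror K x \<in> nbhd K (2*K+4) (mirror K c)" if "x \<in> nbhd K (2*K+4) c" "c \<in> pts K" for x c
    using that lt_mirror[OF assms(1)] by (auto simp: nbhd_def mirror_in_pts)
  have sub: "nbhd K (2*K+4) c \<subseteq> pts K" for c by (auto simp: nbhd_def)
  have "bij_betw (mirror K) (nbhd K (2*K+4) c) (nbhd K (2*K+4) (mirror K c))"
    using *[OF _ assms(2)] *[OF _ mirror_in_pts[OF assms(2)]] sub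
    by (intro bij_betw_byWitness[where f' = "mirror K"])
       (auto simp: subset_iff mirror_mirror assms mirror_in_pts)
  then show ?thesis
    unfolding pt_iso_def using lt_mirror[OF assms(1)] sub by auto
qed

text \<open>Reflect if \<open>b\<close> is not \<open>a\<close>, then insert a twist invisible near
  \<open>b\<close>; flips fix the decoration \<open>b\<close>. Treating all pairs of equal level
  gives (4) for every matching of the cards.\<close>

lemma decor_nbhd_isomorphic:
  assumes "1 \<le> K" "a \<in> pts K" "b \<in> pts K" "decor a" "decor b" "level K a = level K b"
  shows "isomorphic_neighborhoods (rel K (2*K+4) (pts K)) (rel K (2*K+3) (pts K)) (to_nat a) (to_nat b)"
proof -
  have "\<exists>h. pt_iso K (2*K+4) (nbhd K (2*K+4) a) (2*K+4) (nbhd K (2*K+4) b) h"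
    using decor_level_eq[OF assms(2-)]
  proof
    assume "b = a"
    then show ?thesis by (intro exI[of _ id]) (simp add: pt_iso_def)
  qed (use nbhd_mirror_iso[OF assms(1,2)] in blast)
  then have "\<exists>h. pt_iso K (2*K+4) (nbhd K (2*K+4) a) (2*K+3) (nbhd K (2*K+3) b) h"
    using nbhd_pt_iso[OF assms(1,3)] assms(5) by (auto intro: pt_iso_trans)
  then show ?thesis
    using iso_rel unfolding isomorphic_neighborhoods_def isomorphic_def
      neighborhood_rel[OF assms(2)] neighborhood_rel[OF assms(3)] by blast
qed

section \<open>The parity survives the deletion of an undecorated point\<close>

text \<open>
  A walk uses from every pair and every link one point of the same colour. Only the decoration of the
  last pair is twisted, so the end points of a walk look alike in \<open>lt K (2*K+4)\<close> but not in
  \<open>lt K (2*K+3)\<close>.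
\<close>

fun colour :: "pt \<Rightarrow> bool" where
  "colour (Q j x) = (x \<noteq> odd j)"
| "colour (G i y z) = (y \<noteq> odd i)"
| "colour (E b y) = y"
| "colour _ = False"

fun crossing :: "pt \<Rightarrow> bool" where
  "crossing (G i y z) = (y \<noteq> z)"
| "crossing (E b y) = True"
| "crossing _ = False"

text \<open>A crossing \<open>G\<close> joins opposite labels of adjacent pairs, and
  \<open>colour\<close> corrects labels by the parity of the pair. The links \<open>E\<close> behave
  alike, since the twist at \<open>2*K+3\<close> does not sit at one of them.\<close>

lemma colour_eq:
  assumes "crossing z" "lt K (2*K+3) (Q j x) z"
  shows "colour z = (x \<noteq> odd j)"
  using assms by (cases z) (auto split: if_splits)

lemma below_crossing:
  assumes "crossing z" "lt K d a z"
  shows "(\<exists>b. a = V b) \<or> (\<exists>j x. a = Q j x)"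
  using assms by (cases z; cases a) auto

definition walk :: "bool \<Rightarrow> nat \<Rightarrow> pt" where
  "walk \<kappa> j = Q j (\<kappa> \<noteq> odd j)"

definition walk_edge :: "nat \<Rightarrow> bool \<Rightarrow> nat \<Rightarrow> pt" where
  "walk_edge K \<kappa> j = (if j = 0 then E False \<kappa> else if j = 2*K+1 then E True \<kappa>
     else G j (\<kappa> \<noteq> odd j) (\<kappa> = odd j))"

lemma walk_in_pts: "j \<le> 2*K+2 \<Longrightarrow> walk \<kappa> j \<in> pts K"
  "j \<le> 2*K+1 \<Longrightarrow> walk_edge K \<kappa> j \<in> pts K"
  by (auto simp: walk_def walk_edge_def)

lemma colour_walk: "colour (walk \<kappa> j) = \<kappa>" "colour (walk_edge K \<kappa> j) = \<kappa>"
  by (auto simp: walk_def walk_edge_def)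

lemma lt_walk:
  assumes "j \<le> 2*K+1"
  shows "lt K (2*K+4) (walk \<kappa> j) (walk_edge K \<kappa> j)"
    "lt K (2*K+4) (walk \<kappa> (Suc j)) (walk_edge K \<kappa> j)"
  using assms by (auto simp: walk_def walk_edge_def)

text \<open>An inner edge of a walk lies below the reflection of its own decoration but not below
  that decoration; the outer edges are separated by the two maximal points. This describes the edges
  by the order alone.\<close>

lemma walk_edge_crossed:
  assumes "1 \<le> K" "j \<le> 2*K+1"
  shows "\<exists>i k. 1 \<le> i \<and> i \<le> 2*K \<and> 1 \<le> k \<and> k \<le> 2*K \<and> lev K i = lev K k \<and>
    lt K (2*K+4) (walk_edge K \<kappa> j) (U i) \<and> \<not> lt K (2*K+4) (walk_edge K \<kappa> j) (U k)"
proof -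
  consider "j = 0" | "j = 2*K+1" | "1 \<le> j" "j \<le> 2*K" using assms by linarith
  then show ?thesis
  proof cases
    case 1
    with assms show ?thesis
      by (intro exI[of _ "2*K"] exI[of _ 1]) (auto simp: walk_edge_def lev_def)
  next
    case 2
    with assms show ?thesis
      by (intro exI[of _ 1] exI[of _ "2*K"]) (auto simp: walk_edge_def lev_def)
  next
    case 3
    then have "lev K (2*K+1-j) = lev K j" "2*K+1-j \<noteq> j" by (auto simp: lev_def) arith
    with 3 show ?thesis
      by (intro exI[of _ "2*K+1-j"] exI[of _ j]) (auto simp: walk_edge_def)
  qed
qed

text \<open>If a \<open>G\<close> lies below one \<open>U\<close> but not below another of the same
  level, the latter is its own decoration, and since the twist is elsewhere its labels differ
  there.\<close>

lemma crossingI: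
  assumes "lt K d z (U i)" "\<not> lt K d z (U k)" "lev K i = lev K k" "d = 2*K+3" "k \<le> 2*K"
  shows "crossing z"
  using assms by (cases z) auto

text \<open>Decorations above the row are recognised by having a chain of three points below and an
  incomparable point of the same kind.\<close>

lemma tall_incomparable:
  assumes "a \<in> pts K" "b \<in> pts K" "3 \<le> level K a" "3 \<le> level K b" "a \<noteq> b"
    "\<not> lt K d a b" "\<not> lt K d b a"
  shows "\<exists>i k. a = U i \<and> b = U k \<and> lev K i = lev K k \<and> k \<le> 2*K"
  using assms by (cases a; cases b) auto

text \<open>Recognises the \<open>V b\<close> from the order alone, also in cards at undecorated
  points.\<close>

lemma V_iff_minimal:
  assumes "z \<in> pts K" "\<And>b. V b \<in> A" "A \<subseteq> pts K" "1 \<le> K"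
  shows "(\<exists>b. z = V b) \<longleftrightarrow> \<not> (\<exists>w \<in> A. lt K d w z)"
proof
  assume "\<not> (\<exists>w \<in> A. lt K d w z)"
  with assms(2) have "\<not> lt K d (V True) z" "\<not> lt K d (V False) z" by blast+
  with assms show "\<exists>b. z = V b" by (cases z) (auto split: if_splits)
next
  assume "\<exists>b. z = V b"
  then obtain b where "z = V b" ..
  then show "\<not> (\<exists>w \<in> A. lt K d w z)"
    using lt_level[of z K] assms(1,3) by (metis level.simps(1) not_less_zero subsetD)
qed

text \<open>The conditions on \<open>A\<close> and \<open>B\<close> cover the full sets and the
  cards at undecorated points together. A walk that avoids \<open>x\<close> is mapped onto a full
  walk of one colour, ends to ends, but the ends of a walk look alike only without the
  twist.\<close>

lemma no_pt_iso:
  assumes K: "1 \<le> K" and x: "\<not> decor x" and A: "pts K - {x} \<subseteq> A" "A \<subseteq> pts K"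
    and B: "B \<subseteq> pts K" "\<And>c. decor c \<Longrightarrow> c \<in> pts K \<Longrightarrow> c \<in> B"
    and iso: "pt_iso K (2*K+4) A (2*K+3) B h"
  shows False
proof -
  \<comment> \<open>Of the two disjoint walks, this selects the one without
    \<open>x\<close>.\<close>
  define \<kappa> where "\<kappa> = (\<not> colour x)"
  let ?q = "walk \<kappa>" and ?e = "walk_edge K \<kappa>"
  have bij: "bij_betw h A B"
    and lt: "\<And>a b. a \<in> A \<Longrightarrow> b \<in> A \<Longrightarrow> lt K (2*K+4) a b \<longleftrightarrow> lt K (2*K+3) (h a) (h b)"
    using iso by (auto simp: pt_iso_def)
  have inj: "h a = h b \<longleftrightarrow> a = b" if "a \<in> A" "b \<in> A" for a b
    using bij that by (auto simp: bij_betw_def inj_on_eq_iff)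
  have hB: "h a \<in> B" if "a \<in> A" for a using bij that by (auto simp: bij_betw_def)
  have surj: "\<exists>a \<in> A. b = h a" if "b \<in> B" for b using bij that by (auto simp: bij_betw_def)
  have dA: "c \<in> A" if "decor c" "c \<in> pts K" for c using that x A(1) by auto
  have qA: "?q j \<in> A" if "j \<le> 2*K+2" for j
    using walk_in_pts(1)[OF that, of \<kappa>] colour_walk(1)[of \<kappa> j] A(1) by (auto simp: \<kappa>_def)
  have eA: "?e j \<in> A" if "j \<le> 2*K+1" for j
    using walk_in_pts(2)[OF that, of \<kappa>] colour_walk(2)[of K \<kappa> j] A(1) by (auto simp: \<kappa>_def)
  have VA: "V b \<in> A" and VB: "V b \<in> B" for b using dA B(2) by auto
  have Viff: "(\<exists>b. a = V b) \<longleftrightarrow> (\<exists>b. h a = V b)" if "a \<in> A" for a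
  proof -
    have "(\<exists>w \<in> A. lt K (2*K+4) w a) \<longleftrightarrow> (\<exists>w \<in> B. lt K (2*K+3) w (h a))"
      using lt hB surj that by metis
    moreover have "a \<in> pts K" "h a \<in> pts K" using that hB A(2) B(1) by auto
    ultimately show ?thesis
      using V_iff_minimal[OF _ VA A(2) K, of a "2*K+4"] V_iff_minimal[OF _ VB B(1) K, of "h a" "2*K+3"]
      by simp
  qed
  \<comment> \<open>\<open>h\<close> may exchange the two \<open>V b\<close>, so only the property
    of lying above both is carried over.\<close>
  have above_V: "(\<forall>b. lt K (2*K+4) (V b) a) \<longleftrightarrow> (\<forall>b. lt K (2*K+3) (V b) (h a))" if "a \<in> A" for a
  proof
    assume *: "\<forall>b. lt K (2*K+4) (V b) a"
    show "\<forall>b. lt K (2*K+3) (V b) (h a)"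
    proof
      fix b
      obtain w where "w \<in> A" "V b = h w" using surj[OF VB] by blast
      with Viff obtain c where "w = V c" by metis
      with * \<open>V b = h w\<close> lt[OF VA that] show "lt K (2*K+3) (V b) (h a)" by metis
    qed
  next
    assume *: "\<forall>b. lt K (2*K+3) (V b) (h a)"
    show "\<forall>b. lt K (2*K+4) (V b) a"
    proof
      fix b
      obtain c where "h (V b) = V c" using Viff[OF VA] by blast
      with * lt[OF VA that] show "lt K (2*K+4) (V b) a" by metis
    qed
  qed
  have tall: "3 \<le> level K (h (U i))" if "1 \<le> i" "i \<le> 2*K" for i
  proof -
    \<comment> \<open>At most one of the three \<open>W\<close> is deleted; \<open>V True\<close>
      and two remaining ones form a chain of three points below \<open>U i\<close>.\<close>
    obtain k l where kl: "k < l" "l < 3" "W k \<noteq> x" "W l \<noteq> x"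
    proof (cases "x = W 0")
      case True then show ?thesis using that[of 1 2] by simp
    next
      case False
      show ?thesis
      proof (cases "x = W 1")
        case True then show ?thesis using that[of 0 2] by simp
      next
        case False with \<open>x \<noteq> W 0\<close> show ?thesis using that[of 0 1] by auto
      qed
    qed
    have mem: "W k \<in> A" "W l \<in> A" "U i \<in> A" using kl that A(1) dA[of "U i"] by auto
    have "lt K (2*K+3) (h (V True)) (h (W k))" "lt K (2*K+3) (h (W k)) (h (W l))"
      "lt K (2*K+3) (h (W l)) (h (U i))"
      using lt[of "V True" "W k"] lt[of "W k" "W l"] lt[of "W l" "U i"] mem VA kl by auto
    moreover have "h (V True) \<in> pts K" "h (W k) \<in> pts K" "h (W l) \<in> pts K" "h (U i) \<in> pts K"
      using hB mem VA B(1) by auto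
    ultimately have "level K (h (V True)) < level K (h (W k))" "level K (h (W k)) < level K (h (W l))"
      "level K (h (W l)) < level K (h (U i))" by (auto intro: lt_level)
    then show ?thesis by linarith
  qed
  \<comment> \<open>The images of the two separating \<open>U\<close> are incomparable and high,
    hence again two \<open>U\<close> of one level, and they show that the image of the edge is a
    crossing.\<close>
  have cross: "crossing (h (?e j))" if j: "j \<le> 2*K+1" for j
  proof -
    obtain i k where ik: "1 \<le> i" "i \<le> 2*K" "1 \<le> k" "k \<le> 2*K" "lev K i = lev K k"
      and *: "lt K (2*K+4) (?e j) (U i)" "\<not> lt K (2*K+4) (?e j) (U k)"
      using walk_edge_crossed[OF K j] by blast
    have mem: "U i \<in> A" "U k \<in> A" using dA ik by auto
    have "U i \<noteq> U k" using * by auto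
    then have "h (U i) \<noteq> h (U k)" using inj mem by blast
    moreover have "\<not> lt K (2*K+3) (h (U i)) (h (U k))" "\<not> lt K (2*K+3) (h (U k)) (h (U i))"
      using lt[OF mem] lt[OF mem(2,1)] ik by auto
    moreover have "h (U i) \<in> pts K" "h (U k) \<in> pts K" using hB mem B(1) by auto
    ultimately obtain i' k' where "h (U i) = U i'" "h (U k) = U k'" "lev K i' = lev K k'" "k' \<le> 2*K"
      using tall_incomparable tall ik by meson
    then show ?thesis
      using crossingI[of K "2*K+3" "h (?e j)" i' k'] lt[OF eA[OF j] mem(1)] lt[OF eA[OF j] mem(2)] * by simp
  qed
  have up: "lt K (2*K+3) (h (?q j)) (h (?e j))" "lt K (2*K+3) (h (?q (Suc j))) (h (?e j))"
    if j: "j \<le> 2*K+1" for j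
    using lt[OF qA[of j] eA[OF j]] lt[OF qA[of "Suc j"] eA[OF j]] lt_walk[OF j] j by auto
  have isQ: "\<exists>i x. h (?q j) = Q i x \<and> i \<le> 2*K+2" if j: "j \<le> 2*K+2" for j
  proof -
    have "\<exists>z. crossing z \<and> lt K (2*K+3) (h (?q j)) z"
    proof (cases j)
      case 0
      then show ?thesis using cross[of 0] up(1)[of 0] by auto
    next
      case (Suc i)
      then show ?thesis using cross[of i] up(2)[of i] j by auto
    qed
    moreover have "\<not> (\<exists>b. h (?q j) = V b)"
      using Viff[OF qA[OF j]] by (simp add: walk_def)
    ultimately obtain i x where "h (?q j) = Q i x"
      using below_crossing by blast
    moreover have "h (?q j) \<in> pts K" using hB qA[OF j] B(1) by auto
    ultimately show ?thesis by auto
  qed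
  define c where "c = colour (h (?q 0))"
  have colour_e: "colour (h (?e j)) = colour (h (?q j))"
    "colour (h (?e j)) = colour (h (?q (Suc j)))" if "j \<le> 2*K+1" for j
  proof -
    obtain i x i' x' where eq: "h (?q j) = Q i x" "h (?q (Suc j)) = Q i' x'"
      using isQ[of j] isQ[of "Suc j"] \<open>j \<le> 2*K+1\<close> by auto
    show "colour (h (?e j)) = colour (h (?q j))"
      by (simp only: eq colour_eq[OF cross[OF that] up(1)[OF that, unfolded eq]] colour.simps)
    show "colour (h (?e j)) = colour (h (?q (Suc j)))"
      by (simp only: eq colour_eq[OF cross[OF that] up(2)[OF that, unfolded eq]] colour.simps)
  qed
  have col: "colour (h (?q j)) = c" if "j \<le> 2*K+2" for j
    using that
  proof (induction j)
    case (Suc j)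
    then show ?case using colour_e[of j] by simp
  qed (simp add: c_def)
  have "\<exists>i. h (?q j) = walk c i \<and> i \<le> 2*K+2" if j: "j \<le> 2*K+2" for j
    using isQ[OF j] col[OF j] by (auto simp: walk_def)
  \<comment> \<open>Within one colour a point is determined by its pair, so \<open>h\<close> acts on
    the walk through a map \<open>t\<close> of pair indices.\<close>
  then obtain t where t: "\<And>j. j \<le> 2*K+2 \<Longrightarrow> h (?q j) = walk c (t j) \<and> t j \<le> 2*K+2"
    by metis
  have "inj_on t {..2*K+2}"
  proof (rule inj_onI)
    fix i j assume ij: "i \<in> {..2*K+2}" "j \<in> {..2*K+2}" "t i = t j"
    then have "h (?q i) = h (?q j)" using t by simp
    then have "?q i = ?q j" using inj qA ij by simp
    then show "i = j" by (simp add: walk_def)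
  qed
  moreover have "t ` {..2*K+2} \<subseteq> {..2*K+2}" using t by auto
  ultimately have t_surj: "t ` {..2*K+2} = {..2*K+2}"
    by (intro endo_inj_surj) auto
  \<comment> \<open>An inner point of the walk lies below two of its edges, whereas a point of an
    end pair lies below only one crossing, an \<open>E\<close>. So only ends can be mapped to
    ends.\<close>
  have ends: "j = 0 \<or> j = 2*K+2" if j: "j \<le> 2*K+2" and tj: "t j = 0 \<or> t j = 2*K+2" for j
  proof (rule ccontr)
    assume "\<not> (j = 0 \<or> j = 2*K+2)"
    then obtain i where i: "j = Suc i" "Suc i \<le> 2*K+1" using j by (cases j) auto
    have *: "h (?e i') = E (t j \<noteq> 0) c" if "i' \<le> 2*K+1" "lt K (2*K+3) (h (?q j)) (h (?e i'))" for i'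
    proof -
      have "lt K (2*K+3) (walk c (t j)) (h (?e i'))" "h (?e i') \<in> pts K"
        using that t[OF j] hB eA B(1) by auto
      then show ?thesis
        using cross[OF that(1)] tj K by (cases "h (?e i')") (auto simp: walk_def split: if_splits)
    qed
    have "h (?e i) = h (?e (Suc i))"
      using *[of i] *[of "Suc i"] up(2)[of i] up(1)[of "Suc i"] i by simp
    then have "?e i = ?e (Suc i)" using inj eA i by simp
    then show False using i by (auto simp: walk_edge_def split: if_splits)
  qed
  \<comment> \<open>Without the twist both end decorations select the label \<open>False\<close>,
    and both ends of the walk carry the label \<open>\<kappa>\<close>.\<close>
  have val: "(\<forall>b. lt K (2*K+3) (V b) (walk c (t j))) \<longleftrightarrow> \<not> \<kappa>" if "j = 0 \<or> j = 2*K+2" for j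
  proof -
    have "(\<forall>b. lt K (2*K+4) (V b) (?q j)) \<longleftrightarrow> \<not> \<kappa>"
      using that K by (auto simp: walk_def all_bool_eq)
    moreover have "h (?q j) = walk c (t j)" "j \<le> 2*K+2" using t that by auto
    ultimately show ?thesis using above_V[OF qA[of j]] by (simp only:)
  qed
  have "0 \<in> t ` {..2*K+2}" "2*K+2 \<in> t ` {..2*K+2}" unfolding t_surj by auto
  then obtain j j' where "j \<le> 2*K+2" "t j = 0" "j' \<le> 2*K+2" "t j' = 2*K+2" by auto
  then have "(\<forall>b. lt K (2*K+3) (V b) (walk c 0)) \<longleftrightarrow> (\<forall>b. lt K (2*K+3) (V b) (walk c (2*K+2)))"
    using ends[of j] ends[of j'] val[of j] val[of j'] by simp
  \<comment> \<open>In the twisted order the end decorations select opposite labels, while both ends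
    of the image carry the label \<open>c\<close>.\<close>
  then show False
    using K by (auto simp: walk_def all_bool_eq)
qed

section \<open>Decks, cards and equal card ratio of the two orders\<close>

abbreviation ord :: "nat \<Rightarrow> nat \<Rightarrow> nat rel" where
  "ord K d \<equiv> rel K d (pts K)"

lemma rank_points_ord:
  "1 \<le> K \<Longrightarrow> rank_points (ord K d) k = to_nat ` {c \<in> pts K. level K c = k}"
  by (auto simp: rank_points_def rank_rel)

lemma minimals_ord:
  assumes "1 \<le> K"
  shows "minimals (ord K d) = to_nat ` range V"
proof -
  have "to_nat a \<in> minimals (ord K d) \<longleftrightarrow> a \<in> range V" if "a \<in> pts K" for a
  proof -
    have "(\<forall>y. (y, to_nat a) \<in> ord K d \<longrightarrow> y = to_nat a) \<longleftrightarrow> \<not> (\<exists>w \<in> pts K. lt K d w a)"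
      using that by (auto simp: rel_def)
    also have "\<dots> \<longleftrightarrow> (\<exists>b. a = V b)"
      using V_iff_minimal[OF that _ _ assms, of "pts K" d] by simp
    finally show ?thesis using that by (auto simp: minimals_def)
  qed
  then have "{a \<in> pts K. to_nat a \<in> minimals (ord K d)} = range V" by auto
  moreover have "minimals (ord K d) = to_nat ` {a \<in> pts K. to_nat a \<in> minimals (ord K d)}"
    by (auto simp: minimals_def)
  ultimately show ?thesis by metis
qed

lemma maximals_ord:
  assumes "1 \<le> K"
  shows "maximals (ord K d) = to_nat ` {U 1, U (2*K)}"
proof -
  have top: "\<not> lt K d a w" if "a = U 1 \<or> a = U (2*K)" "w \<in> pts K" for a w
    using that by (cases w) (auto simp: lev_def split: if_splits)
  have nontop: "\<exists>i \<in> {1, 2*K}. lt K d a (U i)" if "a \<in> pts K" "a \<noteq> U 1" "a \<noteq> U (2*K)" for a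
    using that assms by (cases a) (auto simp: lev_def)
  have max_iff: "to_nat a \<in> maximals (ord K d) \<longleftrightarrow> a = U 1 \<or> a = U (2*K)" if "a \<in> pts K" for a
  proof
    assume *: "to_nat a \<in> maximals (ord K d)"
    show "a = U 1 \<or> a = U (2*K)"
    proof (rule ccontr)
      assume "\<not> (a = U 1 \<or> a = U (2*K))"
      then have "a \<noteq> U 1" "a \<noteq> U (2*K)" by simp_all
      from nontop[OF that this] obtain i where i: "i \<in> {1, 2*K}" "lt K d a (U i)" by (elim bexE)
      from i(1) have "U i \<in> pts K" using assms by auto
      then have "(to_nat a, to_nat (U i)) \<in> ord K d" unfolding in_rel using that i(2) by blast
      then have "to_nat (U i) = to_nat a" using * unfolding maximals_def by blast
      then have "U i = a" by simp
      with i(2) show False using lt_irrefl by blast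
    qed
  next
    assume "a = U 1 \<or> a = U (2*K)"
    then have "y = to_nat a" if "(to_nat a, y) \<in> ord K d" for y
      using top[of a] that by (auto simp: rel_def simp del: lt.simps)
    then show "to_nat a \<in> maximals (ord K d)" using that by (simp add: maximals_def)
  qed
  have "U 1 \<in> pts K" "U (2*K) \<in> pts K" using assms by auto
  with max_iff have "{a \<in> pts K. to_nat a \<in> maximals (ord K d)} = {U 1, U (2*K)}" by blast
  moreover have "maximals (ord K d) = to_nat ` {a \<in> pts K. to_nat a \<in> maximals (ord K d)}"
    by (auto simp: maximals_def)
  ultimately show ?thesis by metis
qed

lemma iso_decor_cards:
  assumes "decor c" "c \<in> pts K"
  shows "iso (point_deleted (ord K (2*K+4)) (to_nat c)) (point_deleted (ord K (2*K+3)) (to_nat c))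
    (nat_map (flip K (twist K c)))"
  unfolding point_deleted_rel by (rule iso_rel[OF pt_iso_card[OF assms]])

lemma decor_cards:
  assumes "1 \<le> K" "decor c" "c \<in> pts K"
  shows "isomorphic_cards (ord K (2*K+4)) (ord K (2*K+3)) (to_nat c) (to_nat c)"
    "rank_marked_cards (ord K (2*K+4)) (ord K (2*K+3)) (to_nat c) (to_nat c)"
    "max_marked_cards (ord K (2*K+4)) (ord K (2*K+3)) (to_nat c) (to_nat c)"
    "min_marked_cards (ord K (2*K+4)) (ord K (2*K+3)) (to_nat c) (to_nat c)"
  using iso_decor_cards[OF assms(2,3)] assms(1)
  unfolding isomorphic_cards_def isomorphic_def rank_marked_cards_def max_marked_cards_def
    min_marked_cards_def
  by (auto intro!: exI simp: rank_rel maximals_ord minimals_ord)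

lemma decks_equal_same:
  assumes "\<And>c. c \<in> A \<Longrightarrow> R (to_nat c) (to_nat c)"
  shows "decks_equal (to_nat ` A) (to_nat ` A) R"
  unfolding decks_equal_def using assms by (intro exI[of _ id]) auto

text \<open>The \<open>W\<close> push the \<open>U\<close> up to level \<open>5\<close>, so the
  levels without decorations are \<open>1\<close> to \<open>4\<close>.\<close>

lemma decor_iff_level:
  assumes "c \<in> pts K"
  shows "decor c \<longleftrightarrow> level K c = 0 \<or> 5 \<le> level K c"
  using assms by (cases c) auto

lemma rank_neighborhood_decks:
  assumes "1 \<le> K"
  shows "equal_rank_neighborhood_decks k (ord K (2*K+4)) (ord K (2*K+3))"
  unfolding equal_rank_neighborhood_decks_def decks_equal_def rank_points_ord[OF assms]
proof (intro exI conjI ballI)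
  let ?L = "{c \<in> pts K. level K c = k}"
  show "bij_betw (nat_map (flip K (2*K+2))) (to_nat ` ?L) (to_nat ` ?L)"
    by (intro bij_betw_nat_map bij_flip) simp
  fix x assume "x \<in> to_nat ` ?L"
  then obtain c where c: "c \<in> pts K" "x = to_nat c" by auto
  have "isomorphic (rel K (2*K+4) (nbhd K (2*K+4) c))
      (rel K (2*K+3) (nbhd K (2*K+3) (flip K (2*K+2) c)))"
    using iso_rel[OF nbhd_pt_iso[OF assms c(1)]] by (auto simp: isomorphic_def)
  then show "isomorphic_neighborhoods (ord K (2*K+4)) (ord K (2*K+3)) x (nat_map (flip K (2*K+2)) x)"
    using c by (simp add: isomorphic_neighborhoods_def neighborhood_rel)
qed

lemma not_isomorphic:
  assumes "1 \<le> K"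
  shows "\<not> isomorphic (ord K (2*K+4)) (ord K (2*K+3))"
proof
  assume "isomorphic (ord K (2*K+4)) (ord K (2*K+3))"
  then obtain h where "pt_iso K (2*K+4) (pts K) (2*K+3) (pts K) h"
    using isomorphic_relD by blast
  \<comment> \<open>\<open>W 0\<close> stands for an arbitrary undecorated point; here nothing is
    deleted.\<close>
  then show False by (rule no_pt_iso[OF assms, of "W 0", rotated -1]) auto
qed

lemma no_isomorphic_cards:
  assumes "1 \<le> K" "\<not> decor a" "\<not> decor b"
  shows "\<not> isomorphic_cards (ord K (2*K+4)) (ord K (2*K+3)) (to_nat a) (to_nat b)"
proof
  assume "isomorphic_cards (ord K (2*K+4)) (ord K (2*K+3)) (to_nat a) (to_nat b)"
  then obtain h where "pt_iso K (2*K+4) (pts K - {a}) (2*K+3) (pts K - {b}) h"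
    unfolding isomorphic_cards_def point_deleted_rel using isomorphic_relD by blast
  then show False
    by (rule no_pt_iso[OF assms(1,2), rotated -1]) (use assms(3) in auto)
qed

text \<open>A rank with a decoration \<open>c\<close> has isomorphic cards at \<open>c\<close>
  itself. At the other nonempty ranks both deleted points are undecorated, and the parity tells the
  cards apart.\<close>

lemma bad_ranks:
  assumes "1 \<le> K"
  shows "{k. (rank_points (ord K (2*K+4)) k \<noteq> {} \<or> rank_points (ord K (2*K+3)) k \<noteq> {}) \<and>
     \<not> (\<exists>x \<in> rank_points (ord K (2*K+4)) k. \<exists>y \<in> rank_points (ord K (2*K+3)) k.
          isomorphic_cards (ord K (2*K+4)) (ord K (2*K+3)) x y)} = {1, 2, 3, 4}"
    (is "?bad = _")
proof (intro set_eqI iffI)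
  fix k assume bad: "k \<in> ?bad"
  then obtain c where c: "c \<in> pts K" "level K c = k"
    by (auto simp: rank_points_ord[OF assms])
  have "\<not> decor c"
  proof
    assume "decor c"
    then show False
      using bad decor_cards(1)[OF assms \<open>decor c\<close> c(1)] c by (auto simp: rank_points_ord[OF assms])
  qed
  then show "k \<in> {1, 2, 3, 4}" using decor_iff_level[OF c(1)] c(2) by auto
next
  fix k :: nat assume k: "k \<in> {1, 2, 3, 4}"
  have "\<exists>c \<in> pts K. level K c = k"
    using k by (auto intro: bexI[of _ "Q 0 True"] bexI[of _ "W 0"] bexI[of _ "W 1"] bexI[of _ "W 2"])
  moreover have "\<not> decor c" if "c \<in> pts K" "level K c = k" for c
    using that k decor_iff_level[OF that(1)] by auto
  then have "\<not> isomorphic_cards (ord K (2*K+4)) (ord K (2*K+3)) (to_nat a) (to_nat b)"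
    if "a \<in> pts K" "level K a = k" "b \<in> pts K" "level K b = k" for a b
    using no_isomorphic_cards[OF assms] that by blast
  ultimately show "k \<in> ?bad" by (auto simp: rank_points_ord[OF assms])
qed

text \<open>The identity matches the cards at all \<open>2*K+2\<close> decorations, and the bound
  \<open>14*K+15\<close> on the number of points is at most ten times that.\<close>

lemma ECR_ge:
  assumes "1 \<le> K"
  shows "ECR (ord K (2*K+4)) (ord K (2*K+3)) \<ge> 1/10"
proof -
  let ?P = "\<lambda>A. A \<subseteq> Field (ord K (2*K+4)) \<and> (\<exists>f. inj_on f A \<and> f ` A \<subseteq> Field (ord K (2*K+3)) \<and>
    (\<forall>x \<in> A. isomorphic_cards (ord K (2*K+4)) (ord K (2*K+3)) x (f x)))"
  let ?D = "{V True, V False} \<union> U ` {1..2*K}"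
  have D: "?P (to_nat ` ?D)"
    using assms by (intro conjI exI[of _ id]) (auto intro!: decor_cards(1))
  have "card ?D = 2*K+2"
    by (subst card_Un_disjoint) (auto simp: card_image inj_on_def)
  then have card: "card (to_nat ` ?D) = 2*K+2"
    by (subst card_image) (auto simp: inj_on_def)
  have fin: "finite {card A | A. ?P A}"
  proof (rule finite_subset)
    show "{card A | A. ?P A} \<subseteq> card ` Pow (Field (ord K (2*K+4)))" by blast
  qed (simp add: finite_pts)
  have "2*K+2 \<le> isomorphic_card_count (ord K (2*K+4)) (ord K (2*K+3))"
    unfolding isomorphic_card_count_def
  proof (rule Max_ge[OF fin], rule CollectI, rule exI, rule conjI)
    show "2*K+2 = card (to_nat ` ?D)" by (rule card[symmetric])
  qed (rule D)
  moreover have "0 < card (pts K)" using finite_pts[of K] in_pts(1)[of True K] by (metis card_gt_0_iff empty_iff)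
  moreover have "card (pts K) \<le> 10 * (2*K+2)" by (rule order.trans[OF card_pts]) simp
  moreover have "card (to_nat ` pts K) = card (pts K)" by (simp add: card_image inj_on_def)
  ultimately show ?thesis by (simp add: ECR_def field_simps)
qed

section \<open>The sequence of pairs\<close>

theorem theorem3p5:
  shows "\<exists>(P1 :: nat \<Rightarrow> nat rel) (P2 :: nat \<Rightarrow> nat rel).
    (\<forall>n \<ge> 1.
      finite_order (P1 n) \<and> finite_order (P2 n) \<and>
      card (Field (P1 n)) = card (Field (P2 n)) \<and>
      \<not> isomorphic (P1 n) (P2 n) \<and>
      equal_marked_maximal_decks (P1 n) (P2 n) \<and>
      equal_marked_minimal_decks (P1 n) (P2 n) \<and>
      (\<forall>x \<in> maximals (P1 n). \<forall>y \<in> maximals (P2 n).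
         max_marked_cards (P1 n) (P2 n) x y \<longrightarrow> isomorphic_neighborhoods (P1 n) (P2 n) x y) \<and>
      (\<forall>x \<in> minimals (P1 n). \<forall>y \<in> minimals (P2 n).
         min_marked_cards (P1 n) (P2 n) x y \<longrightarrow> isomorphic_neighborhoods (P1 n) (P2 n) x y) \<and>
      (\<exists>k :: nat \<Rightarrow> nat. inj_on k {0..n} \<and>
        (\<forall>i \<le> n.
          rank_points (P1 n) (k i) \<noteq> {} \<and>
          equal_marked_rank_decks (k i) (P1 n) (P2 n) \<and>
          (\<forall>x \<in> rank_points (P1 n) (k i). \<forall>y \<in> rank_points (P2 n) (k i).
             rank_marked_cards (P1 n) (P2 n) x y \<longrightarrow>
               isomorphic_neighborhoods (P1 n) (P2 n) x y))) \<and>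
      card {k. (rank_points (P1 n) k \<noteq> {} \<or> rank_points (P2 n) k \<noteq> {}) \<and>
               \<not> (\<exists>x \<in> rank_points (P1 n) k. \<exists>y \<in> rank_points (P2 n) k.
                    isomorphic_cards (P1 n) (P2 n) x y)} = 4 \<and>
      (\<forall>k. equal_rank_neighborhood_decks k (P1 n) (P2 n))) \<and>
    liminf (\<lambda>n. ereal (ECR (P1 n) (P2 n))) \<ge> ereal (1/10)"
proof (intro exI conjI allI impI ballI)
  \<comment> \<open>With \<open>K = n + 1\<close> the levels \<open>lev\<close> of the
    \<open>U\<close> run from \<open>0\<close> to \<open>n\<close>, which provides the
    \<open>n + 1\<close> ranks.\<close>
  let ?K = "\<lambda>n::nat. n + 1"
  let ?P1 = "\<lambda>n. ord (?K n) (2 * ?K n + 4)" and ?P2 = "\<lambda>n. ord (?K n) (2 * ?K n + 3)"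
  show "ereal (1/10) \<le> liminf (\<lambda>n. ereal (ECR (?P1 n) (?P2 n)))"
    \<comment> \<open>The bound holds for every member of the sequence, hence for the limit
      inferior.\<close>
    by (rule Liminf_bounded) (intro always_eventually allI, unfold ereal_less_eq, rule ECR_ge, simp)
  fix n :: nat
  have K: "1 \<le> ?K n" by simp
  show "finite_order (?P1 n)" "finite_order (?P2 n)" by (rule finite_order_rel)+
  show "card (Field (?P1 n)) = card (Field (?P2 n))" by simp
  show "\<not> isomorphic (?P1 n) (?P2 n)" by (rule not_isomorphic[OF K])
  show "equal_marked_maximal_decks (?P1 n) (?P2 n)"
    unfolding equal_marked_maximal_decks_def maximals_ord[OF K]
    by (rule decks_equal_same, rule decor_cards(3)[OF K]) auto
  show "equal_marked_minimal_decks (?P1 n) (?P2 n)"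
    unfolding equal_marked_minimal_decks_def minimals_ord[OF K]
    by (rule decks_equal_same, rule decor_cards(4)[OF K]) auto
  show "card {k. (rank_points (?P1 n) k \<noteq> {} \<or> rank_points (?P2 n) k \<noteq> {}) \<and>
      \<not> (\<exists>x \<in> rank_points (?P1 n) k. \<exists>y \<in> rank_points (?P2 n) k.
           isomorphic_cards (?P1 n) (?P2 n) x y)} = 4"
    unfolding bad_ranks[OF K] by simp
  show "equal_rank_neighborhood_decks k (?P1 n) (?P2 n)" for k
    by (rule rank_neighborhood_decks[OF K])
  show "isomorphic_neighborhoods (?P1 n) (?P2 n) x y"
    if "x \<in> maximals (?P1 n)" "y \<in> maximals (?P2 n)" for x y
  proof -
    obtain a b where "x = to_nat a" "y = to_nat b" "a \<in> {U 1, U (2 * ?K n)}" "b \<in> {U 1, U (2 * ?K n)}"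
      using \<open>x \<in> maximals _\<close> \<open>y \<in> maximals _\<close> unfolding maximals_ord[OF K] by blast
    then show ?thesis
      by (simp only:) (rule decor_nbhd_isomorphic[OF K]; auto simp: lev_def)
  qed
  show "isomorphic_neighborhoods (?P1 n) (?P2 n) x y"
    if "x \<in> minimals (?P1 n)" "y \<in> minimals (?P2 n)" for x y
  proof -
    obtain a b where "x = to_nat (V a)" "y = to_nat (V b)"
      using \<open>x \<in> minimals _\<close> \<open>y \<in> minimals _\<close> unfolding minimals_ord[OF K] by blast
    then show ?thesis
      by (simp only:) (rule decor_nbhd_isomorphic[OF K]; simp)
  qed
  \<comment> \<open>The chosen ranks are \<open>5 + i\<close>, those of the decorations
    \<open>U\<close>.\<close>
  show "inj_on (\<lambda>i. 5 + i) {0..n}" by (simp add: inj_on_def)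
  fix i assume i: "i \<le> n"
  have decor: "decor c" if "c \<in> pts (?K n)" "level (?K n) c = 5 + i" for c
    using that decor_iff_level[OF that(1)] by simp
  show "rank_points (?P1 n) (5 + i) \<noteq> {}"
    using i unfolding rank_points_ord[OF K]
    \<comment> \<open>\<open>U (?K n - i)\<close> has distance \<open>i\<close> from the
      middle.\<close>
    by (auto simp: lev_def intro!: exI[of _ "U (?K n - i)"])
  show "equal_marked_rank_decks (5 + i) (?P1 n) (?P2 n)"
    unfolding equal_marked_rank_decks_def rank_points_ord[OF K]
    by (rule decks_equal_same, rule decor_cards(2)[OF K]) (use decor in auto)
  show "isomorphic_neighborhoods (?P1 n) (?P2 n) x y"
    if "x \<in> rank_points (?P1 n) (5 + i)" "y \<in> rank_points (?P2 n) (5 + i)" for x y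
  proof -
    obtain a where "x = to_nat a" "a \<in> pts (?K n)" "level (?K n) a = 5 + i"
      using \<open>x \<in> _\<close> unfolding rank_points_ord[OF K] by blast
    moreover obtain b where "y = to_nat b" "b \<in> pts (?K n)" "level (?K n) b = 5 + i"
      using \<open>y \<in> _\<close> unfolding rank_points_ord[OF K] by blast
    ultimately show ?thesis
      using decor by (simp only:) (rule decor_nbhd_isomorphic[OF K]; simp)
  qed
qed

end
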